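(* Let $\mathcal{I},\mathcal{J}$ be admissible ideals on $\mathbf{N}$. Then $$m(c_0(\mathcal{I}) \cap \ell_\infty,\, c_0(\mathcal{J})\cap \ell_\infty) =\{s \in \ell_\infty: \mathcal{J}\text{-}\lim s\mathbf{1}_E=0 \text{ for all }E \in \mathcal{I}\}.$$
   Context: $\mathbf{N}$ is the set of positive integers. An ideal on $\mathbf{N}$ is a family of subsets of $\mathbf{N}$ closed under finite unions and under taking subsets; it is admissible if it contains every finite subset of $\mathbf{N}$ and is not equal to $\mathcal{P}(\mathbf{N})$. Let $\omega$ be the set of all real sequences indexed by $\mathbf{N}$. A sequence $x\in\omega$ is $\mathcal{I}$-convergent to $\eta\in\mathbf{R}$, written $\mathcal{I}\text{-}\lim x=\eta$, if $\{n\in\mathbf{N}: |x_n-\eta|>\varepsilon\}\in\mathcal{I}$ for all $\varepsilon>0$. $c_0(\mathcal{I})$ is the vector space of real sequences with $\mathcal{I}$-limit $0$, and $\ell_\infty$ is the space of bounded real sequences. For $s,x\in\omega$, $sx$ denotes the pointwise product $(s_nx_n)_n$; $\mathbf{1}_E$ is the characteristic sequence of $E\subseteq\mathbf{N}$, so $s\mathbf{1}_E$ equals $s_n$ at $n\in E$ and $0$ at $n\notin E$. For $X,Y\subseteq\omega$, the set of multipliers from $X$ into $Y$ is $m(X,Y):=\{s\in\omega: sx\in Y \text{ for all } x\in X\}$. *)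

theory Defs
  imports "HOL-Analysis.Analysis"
begin

text \<open>
  The index set is the set of positive integers. It is introduced as a type of its own, so that
  subsets of it and sequences indexed by it are plain sets and total functions. No arithmetic on
  it is needed.
\<close>

typedef posnat = "{n :: nat. 0 < n}"
  by auto

text \<open>
  The empty family is included among the finite subfamilies \<open>F\<close>, so an ideal contains the
  empty set. For admissible ideals this makes no difference.
\<close>

definition ideal_on :: "'a set set \<Rightarrow> bool" where
  "ideal_on \<I> \<longleftrightarrow>
     (\<forall>F. finite F \<and> F \<subseteq> \<I> \<longrightarrow> \<Union>F \<in> \<I>) \<and> (\<forall>A B. A \<in> \<I> \<and> B \<subseteq> A \<longrightarrow> B \<in> \<I>)"

definition admissible_ideal :: "'a set set \<Rightarrow> bool" where
  "admissible_ideal \<I> \<longleftrightarrow> ideal_on \<I> \<and> (\<forall>A. finite A \<longrightarrow> A \<in> \<I>) \<and> \<I> \<noteq> Pow UNIV"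

definition ideal_convergent :: "'a set set \<Rightarrow> ('a \<Rightarrow> real) \<Rightarrow> real \<Rightarrow> bool" where
  "ideal_convergent \<I> x \<eta> \<longleftrightarrow> (\<forall>\<epsilon>>0. {n. \<bar>x n - \<eta>\<bar> > \<epsilon>} \<in> \<I>)"

definition c0 :: "'a set set \<Rightarrow> ('a \<Rightarrow> real) set" where
  "c0 \<I> = {x. ideal_convergent \<I> x 0}"

definition l_infty :: "('a \<Rightarrow> real) set" where
  "l_infty = {x. bounded (range x)}"

definition multipliers :: "('a \<Rightarrow> real) set \<Rightarrow> ('a \<Rightarrow> real) set \<Rightarrow> ('a \<Rightarrow> real) set" where
  "multipliers X Y = {s. \<forall>x\<in>X. (\<lambda>n. s n * x n) \<in> Y}"

end

theory Submission
  imports Defs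
begin

text \<open>A multiplier \<open>s\<close> is tested on two kinds of sequences. The indicator of a
  set E in \<I> is bounded and \<I>-null (\<open>indicator_in_c0\<close>,
  \<open>indicator_in_l_infty\<close>), which gives the limit condition on \<open>s\<close>. If
  \<open>s\<close> were unbounded, a sequence with finite level sets could be placed on points where
  \<open>s\<close> is huge, so that the product is unbounded
  (\<open>unbounded_product_with_null_sequence\<close>); such a sequence is \<I>-null because \<I>
  contains the finite sets. Conversely, let M bound \<open>s\<close> and B bound \<open>x\<close>.
  Where the product exceeds \<epsilon> in modulus, \<open>x\<close> exceeds \<epsilon>/M, which
  happens only on a set E in \<I>, and \<open>s\<close> exceeds \<epsilon>/B. So the exceptional set
  of the product lies in that of \<open>s\<close> cut down to E, which belongs to \<J>.\<close>

lemma ideal_on_subset: "ideal_on \<I> \<Longrightarrow> A \<in> \<I> \<Longrightarrow> B \<subseteq> A \<Longrightarrow> B \<in> \<I>"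
  unfolding ideal_on_def by blast

lemma mem_l_infty_iff: "x \<in> l_infty \<longleftrightarrow> (\<exists>B>0. \<forall>n. \<bar>x n\<bar> \<le> B)"
  unfolding l_infty_def by (auto simp: bounded_pos)

lemma mem_c0_iff: "x \<in> c0 \<I> \<longleftrightarrow> (\<forall>\<epsilon>>0. {n. \<bar>x n\<bar> > \<epsilon>} \<in> \<I>)"
  by (simp add: c0_def ideal_convergent_def)

lemma l_infty_mult:
  assumes "s \<in> l_infty" "x \<in> l_infty"
  shows "(\<lambda>n. s n * x n) \<in> l_infty"
proof -
  obtain M B where "M > 0" "\<And>n. \<bar>s n\<bar> \<le> M" "B > 0" "\<And>n. \<bar>x n\<bar> \<le> B"
    using assms by (auto simp: mem_l_infty_iff)
  then have "M * B > 0" "\<And>n. \<bar>s n * x n\<bar> \<le> M * B"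
    by (auto simp: abs_mult intro!: mult_mono)
  then show ?thesis
    unfolding mem_l_infty_iff by blast
qed

lemma indicator_in_c0:
  assumes "ideal_on \<I>" "E \<in> \<I>"
  shows "indicat_real E \<in> c0 \<I>"
  unfolding mem_c0_iff
proof (intro allI impI)
  fix \<epsilon> :: real assume "\<epsilon> > 0"
  then have "{n. \<bar>indicat_real E n\<bar> > \<epsilon>} \<subseteq> E"
    by (auto simp: indicator_def split: if_splits)
  then show "{n. \<bar>indicat_real E n\<bar> > \<epsilon>} \<in> \<I>"
    using assms ideal_on_subset by blast
qed

lemma indicator_in_l_infty: "indicat_real E \<in> l_infty"
  unfolding mem_l_infty_iff by (rule exI[of _ 1]) (auto simp: indicator_def)

text \<open>Finite level sets put \<open>x\<close> in \<open>c0\<close> of every ideal containing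
  the finite sets, so the construction mentions no ideal. Weights 1/(k+1) tend to 0 but are too weak
  to tame values of \<open>s\<close> beyond (k+1)^2.\<close>

lemma unbounded_product_with_null_sequence:
  fixes s :: "'a \<Rightarrow> real"
  assumes "s \<notin> l_infty"
  obtains x where "\<And>\<epsilon>. \<epsilon> > 0 \<Longrightarrow> finite {n. \<bar>x n\<bar> > \<epsilon>}" "x \<in> l_infty"
    "(\<lambda>n. s n * x n) \<notin> l_infty"
proof -
  have "\<exists>n. \<bar>s n\<bar> > (real k + 1)^2" for k
  proof (rule ccontr)
    assume "\<nexists>n. \<bar>s n\<bar> > (real k + 1)^2"
    moreover have "(real k + 1)^2 > 0" by simp
    ultimately show False
      using assms unfolding mem_l_infty_iff by (meson not_le)
  qed
  then obtain p where p: "\<And>k. \<bar>s (p k)\<bar> > (real k + 1)^2" by metis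
  \<comment> \<open>\<open>p\<close> need not be injective; taking the least preimage makes \<open>x\<close> well defined
    and only increases its values.\<close>
  define x where "x n = (if n \<in> range p then 1 / (real (LEAST k. p k = n) + 1) else 0)" for n
  show thesis
  proof
    fix \<epsilon> :: real assume "\<epsilon> > 0"
    \<comment> \<open>A value above \<epsilon> has the form 1/(k+1) at the point \<open>p k\<close>,
      so only finitely many k, and hence finitely many points, can occur.\<close>
    have "{n. \<bar>x n\<bar> > \<epsilon>} \<subseteq> p ` {k. real k \<le> 1 / \<epsilon>}"
    proof
      fix n assume "n \<in> {n. \<bar>x n\<bar> > \<epsilon>}"
      then have gt: "\<bar>x n\<bar> > \<epsilon>" by simp
      then have "n \<in> range p" using \<open>\<epsilon> > 0\<close> by (auto simp: x_def split: if_splits)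
      define k where "k = (LEAST k. p k = n)"
      have "p k = n" unfolding k_def using \<open>n \<in> range p\<close> by (metis (mono_tags, lifting) LeastI rangeE)
      moreover have "1 / (real k + 1) > \<epsilon>" using gt \<open>n \<in> range p\<close> by (simp add: x_def k_def)
      then have "real k \<le> 1 / \<epsilon>" using \<open>\<epsilon> > 0\<close> by (simp add: field_simps)
      ultimately show "n \<in> p ` {k. real k \<le> 1 / \<epsilon>}" by blast
    qed
    moreover have "{k. real k \<le> 1 / \<epsilon>} \<subseteq> {..nat \<lfloor>1 / \<epsilon>\<rfloor>}"
      by (auto simp: le_nat_floor)
    ultimately show "finite {n. \<bar>x n\<bar> > \<epsilon>}"
      by (meson finite_atMost finite_imageI finite_subset)
  next
    show "x \<in> l_infty"
      unfolding mem_l_infty_iff by (rule exI[of _ 1]) (auto simp: x_def)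
  next
    \<comment> \<open>The least index of the point \<open>p k\<close> is at most k, so
      \<open>x\<close> is at least 1/(k+1) there. One factor of the square survives and leaves more
      than k.\<close>
    have large: "\<bar>s (p k) * x (p k)\<bar> > real k" for k
    proof -
      have "(LEAST j. p j = p k) \<le> k" by (simp add: Least_le)
      then have x: "x (p k) \<ge> 1 / (real k + 1)"
        by (simp add: x_def frac_le)
      have "real k < (real k + 1)^2 * (1 / (real k + 1))"
        by (simp add: power2_eq_square)
      also have "\<dots> \<le> \<bar>s (p k)\<bar> * \<bar>x (p k)\<bar>"
        using p[of k] x by (intro mult_mono) auto
      finally show ?thesis by (simp add: abs_mult)
    qed
    show "(\<lambda>n. s n * x n) \<notin> l_infty"
    proof
      assume "(\<lambda>n. s n * x n) \<in> l_infty"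
      then obtain B where "\<And>n. \<bar>s n * x n\<bar> \<le> B" by (auto simp: mem_l_infty_iff)
      moreover obtain k where "B < real k" using reals_Archimedean2 by blast
      ultimately show False using large[of k] by (meson less_trans not_le)
    qed
  qed
qed

theorem theorem3p1:
  fixes \<I> \<J> :: "posnat set set"
  assumes "admissible_ideal \<I>" and "admissible_ideal \<J>"
  shows "multipliers (c0 \<I> \<inter> l_infty) (c0 \<J> \<inter> l_infty) =
    {s \<in> l_infty. \<forall>E\<in>\<I>. ideal_convergent \<J> (\<lambda>n. s n * indicat_real E n) 0}"
proof (intro set_eqI iffI)
  have I: "ideal_on \<I>" "\<And>A. finite A \<Longrightarrow> A \<in> \<I>" and J: "ideal_on \<J>"
    using assms by (auto simp: admissible_ideal_def)
  {
    fix s assume s: "s \<in> multipliers (c0 \<I> \<inter> l_infty) (c0 \<J> \<inter> l_infty)"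
    have "s \<in> l_infty"
    proof (rule ccontr)
      assume "s \<notin> l_infty"
      then obtain x where "\<And>\<epsilon>. \<epsilon> > 0 \<Longrightarrow> finite {n. \<bar>x n\<bar> > \<epsilon>}" "x \<in> l_infty"
        and unb: "(\<lambda>n. s n * x n) \<notin> l_infty"
        using unbounded_product_with_null_sequence by blast
      then have "x \<in> c0 \<I> \<inter> l_infty" using I by (auto simp: mem_c0_iff)
      then show False using s unb by (auto simp: multipliers_def)
    qed
    moreover have "(\<lambda>n. s n * indicat_real E n) \<in> c0 \<J>" if "E \<in> \<I>" for E
      using s indicator_in_c0[OF I(1) that] indicator_in_l_infty[of E]
      by (auto simp: multipliers_def)
    ultimately show "s \<in> {s \<in> l_infty. \<forall>E\<in>\<I>. ideal_convergent \<J> (\<lambda>n. s n * indicat_real E n) 0}"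
      by (simp add: c0_def)
  next
    fix s assume "s \<in> {s \<in> l_infty. \<forall>E\<in>\<I>. ideal_convergent \<J> (\<lambda>n. s n * indicat_real E n) 0}"
    then have s: "s \<in> l_infty" and lim: "\<And>E. E \<in> \<I> \<Longrightarrow> (\<lambda>n. s n * indicat_real E n) \<in> c0 \<J>"
      by (auto simp: c0_def)
    obtain M where M: "M > 0" "\<And>n. \<bar>s n\<bar> \<le> M" using s by (auto simp: mem_l_infty_iff)
    have "(\<lambda>n. s n * x n) \<in> c0 \<J>" if x: "x \<in> c0 \<I>" "x \<in> l_infty" for x
      unfolding mem_c0_iff
    proof (intro allI impI)
      fix \<epsilon> :: real assume "\<epsilon> > 0"
      obtain B where B: "B > 0" "\<And>n. \<bar>x n\<bar> \<le> B" using x by (auto simp: mem_l_infty_iff)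
      \<comment> \<open>As M bounds \<open>s\<close>, the threshold \<epsilon>/M puts every n with
        \<open>s n * x n\<close> above \<epsilon> in modulus into E.\<close>
      define E where "E = {n. \<bar>x n\<bar> > \<epsilon> / M}"
      have "E \<in> \<I>" using x(1) \<open>\<epsilon> > 0\<close> M(1) by (simp add: mem_c0_iff E_def)
      \<comment> \<open>On E the indicator is 1, so the level \<epsilon>/B is one for
        \<open>s\<close> itself; it is exceeded wherever the product exceeds \<epsilon>, since B
        bounds \<open>x\<close>.\<close>
      then have "{n. \<bar>s n * indicat_real E n\<bar> > \<epsilon> / B} \<in> \<J>"
        using lim \<open>\<epsilon> > 0\<close> B(1) by (simp add: mem_c0_iff)
      moreover have "{n. \<bar>s n * x n\<bar> > \<epsilon>} \<subseteq> {n. \<bar>s n * indicat_real E n\<bar> > \<epsilon> / B}"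
      proof
        fix n assume "n \<in> {n. \<bar>s n * x n\<bar> > \<epsilon>}"
        then have gt: "\<epsilon> < \<bar>s n\<bar> * \<bar>x n\<bar>" by (simp add: abs_mult)
        also have "\<dots> \<le> M * \<bar>x n\<bar>" using M by (simp add: mult_right_mono)
        finally have "n \<in> E" using M(1) by (simp add: E_def field_simps)
        have "\<bar>s n\<bar> * \<bar>x n\<bar> \<le> \<bar>s n\<bar> * B" using B by (simp add: mult_left_mono)
        then have "\<epsilon> / B < \<bar>s n\<bar>" using gt B(1) by (simp add: field_simps)
        then show "n \<in> {n. \<bar>s n * indicat_real E n\<bar> > \<epsilon> / B}" using \<open>n \<in> E\<close> by simp
      qed
      ultimately show "{n. \<bar>s n * x n\<bar> > \<epsilon>} \<in> \<J>" using J ideal_on_subset by blast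
    qed
    then show "s \<in> multipliers (c0 \<I> \<inter> l_infty) (c0 \<J> \<inter> l_infty)"
      using l_infty_mult[OF s] by (auto simp: multipliers_def)
  }
qed

end
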